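(* Let $\mathbb{F}_q$ be a finite field and let $a,b\in\mathbb{F}_q$. With the point counts defined in the context: (1) If $a,b\neq0$ and $a\neq-b$, then $|V_{6,a,b}^{(2)}(\mathbb{F}_q)|=|V_{6,a,b}^{(3)}(\mathbb{F}_q)|$. (2) If $a=-b\neq0$, then $|V_{6,a,b}^{(2)}(\mathbb{F}_q)|-1=|V_{6,a,b}^{(4)}(\mathbb{F}_q)|$. (3) If $a,b\neq0$, then $|V_{7,a,b}^{(2)}(\mathbb{F}_q)|=|V_{7,a,b}^{(3)}(\mathbb{F}_q)|$.
   Context: Definitions (numbers of distinct solutions in $\mathbb{F}_q$): $|V_{6,a,b}^{(2)}(\mathbb{F}_q)|=|\{x\in\mathbb{F}_q:ax^3-bx^2+x+1=0\}|$, $|V_{6,a,b}^{(3)}(\mathbb{F}_q)|=|\{x\in\mathbb{F}_q:(a+b)x^3+(a+b^2)x^2+2abx+a^2=0\}|$, $|V_{6,a,b}^{(4)}(\mathbb{F}_q)|=|\{x\in\mathbb{F}_q:(a+b^2)x^2+2abx+a^2=0\}|$, $|V_{7,a,b}^{(2)}(\mathbb{F}_q)|=|\{x\in\mathbb{F}_q:ax^3-bx^2+1=0\}|$, $|V_{7,a,b}^{(3)}(\mathbb{F}_q)|=|\{x\in\mathbb{F}_q:ax^3+b^2x^2+2abx+a^2=0\}|$. *)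

theory Defs
  imports Complex_Main
begin

text \<open>
  The finite field with \<open>q\<close> elements is an arbitrary type \<open>'a\<close> of the classes
  \<open>field\<close> and \<open>finite\<close> (so \<open>q\<close> is its cardinality). Each \<open>V\<close> below is the set of its
  rational points, and the point count is its cardinality: roots are counted without
  multiplicity, and the leading coefficients are allowed to vanish.
\<close>

definition V62 :: "'a::{field,finite} \<Rightarrow> 'a \<Rightarrow> 'a set" where
  "V62 a b = {x. a * x^3 - b * x^2 + x + 1 = 0}"

definition V63 :: "'a::{field,finite} \<Rightarrow> 'a \<Rightarrow> 'a set" where
  "V63 a b = {x. (a + b) * x^3 + (a + b^2) * x^2 + 2 * a * b * x + a^2 = 0}"

definition V64 :: "'a::{field,finite} \<Rightarrow> 'a \<Rightarrow> 'a set" where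
  "V64 a b = {x. (a + b^2) * x^2 + 2 * a * b * x + a^2 = 0}"

definition V72 :: "'a::{field,finite} \<Rightarrow> 'a \<Rightarrow> 'a set" where
  "V72 a b = {x. a * x^3 - b * x^2 + 1 = 0}"

definition V73 :: "'a::{field,finite} \<Rightarrow> 'a \<Rightarrow> 'a set" where
  "V73 a b = {x. a * x^3 + b^2 * x^2 + 2 * a * b * x + a^2 = 0}"

end

theory Submission
  imports Defs
begin

text \<open>
  Each equation on the right contains \<open>b\<^sup>2 x\<^sup>2 + 2 a b x + a\<^sup>2 = (b x + a)\<^sup>2\<close>,
  and \<open>0\<close> is never a root of it because \<open>a \<noteq> 0\<close>. Dividing by \<open>x\<^sup>2\<close> and setting \<open>s = (b x + a) / (a x)\<close> makes the
  equation linear in \<open>x\<close> given \<open>s\<close>; eliminating \<open>x\<close> leaves the cubic on the left as the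
  condition on \<open>s\<close>. If \<open>a = - b\<close>, that cubic is \<open>(s + 1) (a s\<^sup>2 + 1)\<close>, and \<open>s = 1 / x - 1\<close> misses
  exactly the root \<open>-1\<close>.
\<close>

lemma bij_betw_V63_V62:
  fixes a b :: "'a::{field,finite}"
  assumes a: "a \<noteq> 0" and ab: "a + b \<noteq> 0"
  shows "bij_betw (\<lambda>x. (b * x + a) / (a * x)) (V63 a b) (V62 a b)"
\<comment> \<open>With \<open>b * x + a = a * s * x\<close>, division by \<open>x^2\<close> leaves
  \<open>(a + b) * x + a + a^2 * s^2 = 0\<close>; the witness is its solution for
  \<open>x\<close>.\<close>
proof (rule bij_betw_byWitness[where f' = "\<lambda>s. - a * (1 + a * s^2) / (a + b)"])
  have V63: "x \<noteq> 0 \<and> (a + b) * x^3 + a * x^2 + (b * x + a)^2 = 0" if "x \<in> V63 a b" for x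
    using that a by (auto simp: V63_def algebra_simps power2_eq_square)
  \<comment> \<open>The cubic times \<open>a\<close> equals
    \<open>(a * s - b) * (1 + a * s^2) + (a + b)\<close>.\<close>
  have V62: "(a * s - b) * (1 + a * s^2) = - (a + b)" if "s \<in> V62 a b" for s
  proof -
    have "a * s^3 - b * s^2 + s + 1 = 0" using that by (simp add: V62_def)
    then show ?thesis by algebra
  qed
  have inv: "- a * (1 + a * s^2) = (a + b) * x"
    if "x \<in> V63 a b" and "s = (b * x + a) / (a * x)" for x s
  proof -
    have "a * s * x = b * x + a" using that(2) V63[OF that(1)] a by (simp add: field_simps)
    then have "x^2 * ((a + b) * x + a + a^2 * s^2) = 0"
      using V63[OF that(1)] by algebra
    then have "(a + b) * x + a + a^2 * s^2 = 0" using V63[OF that(1)] by simp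
    then show ?thesis by algebra
  qed
  show "\<forall>x\<in>V63 a b. - a * (1 + a * ((b * x + a) / (a * x))^2) / (a + b) = x"
    using inv ab by (metis nonzero_mult_div_cancel_left)
  \<comment> \<open>The middle equation is \<open>a * s * x = b * x + a\<close>, so \<open>s\<close>
    is recovered from \<open>x\<close>; since its right side \<open>a\<close> is nonzero, it also
    forces \<open>x \<noteq> 0\<close>.\<close>
  have fwd: "x \<noteq> 0 \<and> (a * s - b) * x = a \<and> (a + b) * x = - a * (1 + a * s^2)"
    if "s \<in> V62 a b" and "x = - a * (1 + a * s^2) / (a + b)" for x s
  proof -
    have x: "(a + b) * x = - a * (1 + a * s^2)" using that(2) ab by simp
    then have "(a + b) * ((a * s - b) * x - a) = 0" using V62[OF that(1)] by algebra
    then have "(a * s - b) * x = a" using ab by simp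
    then show ?thesis using a x by auto
  qed
  show "\<forall>s\<in>V62 a b. (b * (- a * (1 + a * s^2) / (a + b)) + a) / (a * (- a * (1 + a * s^2) / (a + b))) = s"
  proof
    fix s assume s: "s \<in> V62 a b"
    define x where "x = - a * (1 + a * s^2) / (a + b)"
    have "x \<noteq> 0" "(a * s - b) * x = a" using fwd[OF s x_def] by auto
    then have "(b * x + a) / (a * x) = s" using a by (simp add: field_simps)
    then show "(b * (- a * (1 + a * s^2) / (a + b)) + a) / (a * (- a * (1 + a * s^2) / (a + b))) = s"
      by (simp only: x_def)
  qed
  show "(\<lambda>x. (b * x + a) / (a * x)) ` V63 a b \<subseteq> V62 a b"
  proof clarify
    fix x assume x: "x \<in> V63 a b"
    define s where "s = (b * x + a) / (a * x)"
    have "a * s * x = b * x + a" using V63[OF x] a by (simp add: s_def)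
    \<comment> \<open>Multiplying \<open>(a * s - b) * x = a\<close> by \<open>a + b\<close> and
      replacing \<open>(a + b) * x\<close> by \<open>- a * (1 + a * s^2)\<close> eliminates
      \<open>x\<close>.\<close>
    then have "a * (a * (a * s^3 - b * s^2 + s + 1)) = 0" using inv[OF x s_def] by algebra
    then show "s \<in> V62 a b" using a by (simp add: V62_def)
  qed
  show "(\<lambda>s. - a * (1 + a * s^2) / (a + b)) ` V62 a b \<subseteq> V63 a b"
  proof clarify
    fix s assume s: "s \<in> V62 a b"
    define x where "x = - a * (1 + a * s^2) / (a + b)"
    have "b * x + a = a * s * x" using fwd[OF s x_def] by algebra
    moreover have "(a + b) * x = - a * (1 + a * s^2)" using fwd[OF s x_def] by blast
    moreover have "(a + b) * x^3 + (a + b^2) * x^2 + 2 * a * b * x + a^2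
        = ((a + b) * x) * x^2 + a * x^2 + (b * x + a)^2" by algebra
    ultimately have "(a + b) * x^3 + (a + b^2) * x^2 + 2 * a * b * x + a^2
        = - a * (1 + a * s^2) * x^2 + a * x^2 + (a * s * x)^2" by (simp only:)
    also have "\<dots> = 0" by algebra
    finally show "x \<in> V63 a b" by (simp add: V63_def)
  qed
qed

lemma bij_betw_V73_V72:
  fixes a b :: "'a::{field,finite}"
  assumes a: "a \<noteq> 0"
  shows "bij_betw (\<lambda>x. (b * x + a) / (a * x)) (V73 a b) (V72 a b)"
\<comment> \<open>Here division by \<open>x^2\<close> leaves \<open>a * x + a^2 * s^2 = 0\<close>,
  so the inverse is a polynomial in \<open>s\<close>. It avoids \<open>0\<close> because the cubic
  in \<open>s\<close> has constant term 1.\<close>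
proof (rule bij_betw_byWitness[where f' = "\<lambda>s. - a * s^2"])
  have V73: "x \<noteq> 0 \<and> a * x^3 + (b * x + a)^2 = 0" if "x \<in> V73 a b" for x
    using that a by (auto simp: V73_def algebra_simps power2_eq_square)
  have V72: "s \<noteq> 0 \<and> a * s^3 - b * s^2 + 1 = 0" if "s \<in> V72 a b" for s
    using that by (auto simp: V72_def)
  have inv: "- a * s^2 = x" if "x \<in> V73 a b" and "s = (b * x + a) / (a * x)" for x s
  proof -
    have "a * s * x = b * x + a" using that(2) V73[OF that(1)] a by (simp add: field_simps)
    then have "(a * x^2) * (x + a * s^2) = 0" using V73[OF that(1)] by algebra
    then have "x + a * s^2 = 0" using V73[OF that(1)] a by simp
    then show ?thesis by algebra
  qed
  show "\<forall>x\<in>V73 a b. - a * ((b * x + a) / (a * x))^2 = x" using inv by blast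
  show "\<forall>s\<in>V72 a b. (b * (- a * s^2) + a) / (a * (- a * s^2)) = s"
  proof
    fix s assume s: "s \<in> V72 a b"
    have "a * (- a * s^2) \<noteq> 0" using V72[OF s] a by simp
    moreover have "b * (- a * s^2) + a = s * (a * (- a * s^2))" using V72[OF s] by algebra
    ultimately show "(b * (- a * s^2) + a) / (a * (- a * s^2)) = s"
      by (metis nonzero_mult_div_cancel_right)
  qed
  show "(\<lambda>x. (b * x + a) / (a * x)) ` V73 a b \<subseteq> V72 a b"
  proof clarify
    fix x assume x: "x \<in> V73 a b"
    define s where "s = (b * x + a) / (a * x)"
    have "a * s * x = b * x + a" using V73[OF x] a by (simp add: s_def)
    then have "a * (a * s^3 - b * s^2 + 1) = 0" using inv[OF x s_def] by algebra
    then show "s \<in> V72 a b" using a by (simp add: V72_def)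
  qed
  show "(\<lambda>s. - a * s^2) ` V72 a b \<subseteq> V73 a b"
  proof clarify
    fix s assume "s \<in> V72 a b"
    then have "a * s^3 - b * s^2 + 1 = 0" by (simp add: V72_def)
    \<comment> \<open>The left side is a difference of squares,
      \<open>a^2 * ((1 - b * s^2)^2 - (a * s^3)^2)\<close>, and \<open>a * s^3 - b * s^2 + 1\<close>
      is one of its factors.\<close>
    then have "a * (- a * s^2)^3 + b^2 * (- a * s^2)^2 + 2 * a * b * (- a * s^2) + a^2 = 0"
      by algebra
    then show "- a * s^2 \<in> V73 a b" by (simp add: V73_def)
  qed
qed

lemma V62_uminus_eq: "V62 a (- a) = insert (- 1) {s. a * s^2 + 1 = 0}"
proof -
  have "a * s^3 - (- a) * s^2 + s + 1 = (s + 1) * (a * s^2 + 1)" for s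
    by algebra
  then show ?thesis by (auto simp: V62_def eq_neg_iff_add_eq_0)
qed

text \<open>The case \<open>a = -1\<close> is consistent: the quadratic \<open>a * s^2 + 1\<close>
  then also vanishes at \<open>-1\<close>, while the leading coefficient \<open>a + a^2\<close> in
  \<open>V64\<close> vanishes.\<close>

lemma bij_betw_V64_V62:
  fixes a :: "'a::{field,finite}"
  assumes a: "a \<noteq> 0"
  shows "bij_betw (\<lambda>x. 1 / x - 1) (V64 a (- a)) (V62 a (- a) - {- 1})"
proof (rule bij_betw_byWitness[where f' = "\<lambda>s. 1 / (s + 1)"])
  \<comment> \<open>The conjunct \<open>x \<noteq> 0\<close> matters: as \<open>1 / 0 = 0\<close>,
    the second conjunct would hold at \<open>x = 0\<close> when \<open>a = -1\<close>.\<close>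
  have V64: "x \<in> V64 a (- a) \<longleftrightarrow> x \<noteq> 0 \<and> a * (1 / x - 1)^2 + 1 = 0" for x
  proof (cases "x = 0")
    case True
    then show ?thesis using a by (simp add: V64_def)
  next
    case False
    define s where "s = 1 / x - 1"
    have "(s + 1) * x = 1" using False by (simp add: s_def)
    \<comment> \<open>The left side is \<open>a * x^2 + a^2 * (1 - x)^2\<close>, and
      \<open>1 - x = s * x\<close>.\<close>
    then have "(a + (- a)^2) * x^2 + 2 * a * (- a) * x + a^2 = (a * x^2) * (a * s^2 + 1)"
      by algebra
    then show ?thesis using False a by (simp add: V64_def s_def)
  qed
  show "\<forall>x\<in>V64 a (- a). 1 / (1 / x - 1 + 1) = x" by simp
  show "\<forall>s\<in>V62 a (- a) - {- 1}. 1 / (1 / (s + 1)) - 1 = s" by simp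
  show "(\<lambda>x. 1 / x - 1) ` V64 a (- a) \<subseteq> V62 a (- a) - {- 1}"
    by (auto simp: V64 V62_uminus_eq)
  show "(\<lambda>s. 1 / (s + 1)) ` (V62 a (- a) - {- 1}) \<subseteq> V64 a (- a)"
    by (auto simp: V64 V62_uminus_eq eq_neg_iff_add_eq_0)
qed

theorem theorem1p12:
  fixes a b :: "'a::{field,finite}"
  shows "(a \<noteq> 0 \<and> b \<noteq> 0 \<and> a \<noteq> - b \<longrightarrow> card (V62 a b) = card (V63 a b))
       \<and> (a = - b \<and> a \<noteq> 0 \<longrightarrow> int (card (V62 a b)) - 1 = int (card (V64 a b)))
       \<and> (a \<noteq> 0 \<and> b \<noteq> 0 \<longrightarrow> card (V72 a b) = card (V73 a b))"
proof (intro conjI impI)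
  assume "a \<noteq> 0 \<and> b \<noteq> 0 \<and> a \<noteq> - b"
  then show "card (V62 a b) = card (V63 a b)"
    using bij_betw_same_card[OF bij_betw_V63_V62] by (metis eq_neg_iff_add_eq_0)
next
  assume *: "a = - b \<and> a \<noteq> 0"
  then have b: "b = - a" by simp
  have "- 1 \<in> V62 a b" by (simp add: b V62_uminus_eq)
  then have "card (V62 a b) = Suc (card (V62 a b - {- 1}))"
    by (simp only: card.remove[OF finite])
  also have "card (V62 a b - {- 1}) = card (V64 a b)"
    using bij_betw_same_card[OF bij_betw_V64_V62] * b by metis
  finally show "int (card (V62 a b)) - 1 = int (card (V64 a b))" by simp
next
  assume "a \<noteq> 0 \<and> b \<noteq> 0"
  then show "card (V72 a b) = card (V73 a b)"
    using bij_betw_same_card[OF bij_betw_V73_V72] by metis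
qed

end
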